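(* Let $A$ and $B$ be Banach algebras with bounded approximate identities and let $(E^{<},E^{>})$ be a Morita equivalence between them. Let $I$ be a closed two-sided ideal of $B$ and set $J=\operatorname{Ind}_B^A(I)$, a closed two-sided ideal of $A$. With $$X=E_I^{>},\qquad Y={}_IE^{<},$$ the following conditions are equivalent: (i) $I^2=I$; (ii) $J^2=J$; (iii) with the restricted actions and pairings, the $I$-$J$-bimodule $Y$ and the $J$-$I$-bimodule $X$ form a Morita equivalence $(Y,X)$ between $J$ and $I$. In particular, if either $I$ or $J$ has a bounded approximate identity, then $I$ and $J$ are Morita equivalent via the restricted bimodules.
   Context: All Banach spaces and Banach algebras are complex, and all Banach module actions are contractive. For a subset $S$ of a Banach space, $\overline{\operatorname{span}}\,S$ is its closed linear span. For sets $S,T$ a pairing symbol applied to $(S,T)$ denotes the set of all values on $S\times T$. A bounded approximate identity in a Banach algebra $A$ is a net $(u_\lambda)$ with $\sup_\lambda\|u_\lambda\|<\infty$ and $u_\lambda a\to a$, $au_\lambda\to a$ for every $a\in A$. A Morita equivalence $(E^{<},E^{>})$ between Banach algebras $A$ and $B$ consists of a Banach $B$-$A$-bimodule $E^{<}$, a Banach $A$-$B$-bimodule $E^{>}$, and continuous bilinear pairings $\langle\cdot,\cdot\rangle_B:E^{<}\times E^{>}\to B$ and ${}_A\langle\cdot,\cdot\rangle:E^{>}\times E^{<}\to A$ of norm at most one such that, for all $e^{<},f^{<}\in E^{<}$, $e^{>},f^{>}\in E^{>}$, $a\in A$, $b\in B$: (a) $\langle be^{<},e^{>}\rangle_B=b\langle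 e^{<},e^{>}\rangle_B$, $\langle e^{<},e^{>}b\rangle_B=\langle e^{<},e^{>}\rangle_Bb$, ${}_A\langle ae^{>},e^{<}\rangle=a\,{}_A\langle e^{>},e^{<}\rangle$, ${}_A\langle e^{>},e^{<}a\rangle={}_A\langle e^{>},e^{<}\rangle a$; (b) $\langle e^{<}a,e^{>}\rangle_B=\langle e^{<},ae^{>}\rangle_B$, ${}_A\langle e^{>}b,e^{<}\rangle={}_A\langle e^{>},be^{<}\rangle$; (c) $\langle e^{<},e^{>}\rangle_Bf^{<}=e^{<}\,{}_A\langle e^{>},f^{<}\rangle$, $e^{>}\langle f^{<},f^{>}\rangle_B={}_A\langle e^{>},f^{<}\rangle f^{>}$; (d) both pairings are full: $\overline{\operatorname{span}}\,\langle E^{<},E^{>}\rangle_B=B$ and $\overline{\operatorname{span}}\,{}_A\langle E^{>},E^{<}\rangle=A$; (e) all four module actions are nondegenerate, i.e. the linear span of the module products is dense in the module. For a closed two-sided ideal $I$ of $B$ put $E_I^{>}=\{\xi\in E^{>}:\langle\eta,\xi\rangle_B\in I\ \forall\eta\in E^{<}\}$, ${}_IE^{<}=\{\eta\in E^{<}:\langle\eta,\xi\rangle_B\in I\ \forall\xi\in E^{>}\}$ and $\operatorname{Ind}_B^A(I)=\overline{\operatorname{span}}\,{}_A\langle E_I^{>},E^{<}\rangle$. For a closed ideal $K$ of a Banach algebra, $K^2:=\overline{\operatorname{span}}\,\{k_1k_2:k_1,k_2\in K\}$. The restricted pairings are the restrictions of $\langle\cdot,\cdot\rangle_B$ to $Y\times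 X$ (taking values in $I$) and of ${}_A\langle\cdot,\cdot\rangle$ to $X\times Y$ (taking values in $J$). *)

theory Defs
  imports "HOL-Analysis.Analysis"
begin

text \<open>
  Complex Banach spaces and (not necessarily unital) complex Banach algebras are types.
  Closed ideals of a Banach algebra and closed submodules of a Banach module are subsets of such
  types.  As closed subspaces of complete spaces, they are again Banach algebras and Banach spaces
  for the inherited norm; the notions below are therefore stated relative to carrier sets.
\<close>

class complex_banach = banach +
  fixes scaleC :: "complex \<Rightarrow> 'a \<Rightarrow> 'a"  (infixr \<open>*\<^sub>C\<close> 75)
  assumes scaleC_add_right: "c *\<^sub>C (x + y) = c *\<^sub>C x + c *\<^sub>C y"
    and scaleC_add_left: "(c + d) *\<^sub>C x = c *\<^sub>C x + d *\<^sub>C x"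
    and scaleC_scaleC: "c *\<^sub>C d *\<^sub>C x = (c * d) *\<^sub>C x"
    and scaleC_one: "1 *\<^sub>C x = x"
    and scaleR_scaleC: "r *\<^sub>R x = complex_of_real r *\<^sub>C x"
    and norm_scaleC: "norm (c *\<^sub>C x) = cmod c * norm x"

class complex_banach_algebra = complex_banach + real_normed_algebra +
  assumes mult_scaleC_left: "(c *\<^sub>C x) * y = c *\<^sub>C (x * y)"
    and mult_scaleC_right: "x * (c *\<^sub>C y) = c *\<^sub>C (x * y)"

global_interpretation complex_vector:
  vector_space "scaleC :: complex \<Rightarrow> 'a \<Rightarrow> 'a::complex_banach"
  by unfold_locales (simp_all add: scaleC_add_right scaleC_add_left scaleC_scaleC scaleC_one)

definition closed_span :: "'a::complex_banach set \<Rightarrow> 'a set"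
  where "closed_span S = closure (complex_vector.span S)"

definition closed_csubspace :: "'a::complex_banach set \<Rightarrow> bool"
  where "closed_csubspace S \<longleftrightarrow> complex_vector.subspace S \<and> closed S"

definition closed_subalgebra :: "'a::complex_banach_algebra set \<Rightarrow> bool"
  where "closed_subalgebra A \<longleftrightarrow> closed_csubspace A \<and> (\<forall>x\<in>A. \<forall>y\<in>A. x * y \<in> A)"

definition closed_ideal :: "'a::complex_banach_algebra set \<Rightarrow> bool"
  where "closed_ideal I \<longleftrightarrow> closed_csubspace I \<and> (\<forall>a. \<forall>x\<in>I. a * x \<in> I \<and> x * a \<in> I)"

definition ideal_square :: "'a::complex_banach_algebra set \<Rightarrow> 'a set"
  where "ideal_square K = closed_span {k1 * k2 | k1 k2. k1 \<in> K \<and> k2 \<in> K}"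

text \<open>
  A net is a family indexed by a set that is nonempty and directed for a reflexive and transitive
  relation; its convergence is convergence along the filter generated by the tails.
\<close>

definition directed_index :: "'i set \<Rightarrow> ('i \<Rightarrow> 'i \<Rightarrow> bool) \<Rightarrow> bool"
  where "directed_index \<Lambda> le \<longleftrightarrow> \<Lambda> \<noteq> {} \<and> reflp_on \<Lambda> le \<and> transp_on \<Lambda> le \<and>
    (\<forall>i\<in>\<Lambda>. \<forall>j\<in>\<Lambda>. \<exists>k\<in>\<Lambda>. le i k \<and> le j k)"

definition tails :: "'i set \<Rightarrow> ('i \<Rightarrow> 'i \<Rightarrow> bool) \<Rightarrow> 'i filter"
  where "tails \<Lambda> le = (INF i\<in>\<Lambda>. principal {j\<in>\<Lambda>. le i j})"

definition bounded_approximate_identity ::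
    "'a::complex_banach_algebra set \<Rightarrow> 'i set \<Rightarrow> ('i \<Rightarrow> 'i \<Rightarrow> bool) \<Rightarrow> ('i \<Rightarrow> 'a) \<Rightarrow> bool"
  where "bounded_approximate_identity A \<Lambda> le u \<longleftrightarrow>
    directed_index \<Lambda> le \<and> u ` \<Lambda> \<subseteq> A \<and> bounded (u ` \<Lambda>) \<and>
    (\<forall>a\<in>A. ((\<lambda>i. u i * a) \<longlongrightarrow> a) (tails \<Lambda> le) \<and> ((\<lambda>i. a * u i) \<longlongrightarrow> a) (tails \<Lambda> le))"

text \<open>
  HOL has no quantifier over types, so the type of the indices is an argument of the predicate.
  It is meant to be a type variable in statements where the predicate is a hypothesis: the
  statement then covers nets over arbitrary index types.
\<close>

definition has_bounded_approximate_identity ::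
    "'i itself \<Rightarrow> 'a::complex_banach_algebra set \<Rightarrow> bool"
  where "has_bounded_approximate_identity ty A \<longleftrightarrow>
    (\<exists>(\<Lambda>::'i set) le u. bounded_approximate_identity A \<Lambda> le u)"

text \<open>Complex bilinear maps from \<open>S \<times> T\<close> to \<open>U\<close> of norm at most one.\<close>

definition contractive_bilinear ::
    "'a::complex_banach set \<Rightarrow> 'b::complex_banach set \<Rightarrow> 'c::complex_banach set
      \<Rightarrow> ('a \<Rightarrow> 'b \<Rightarrow> 'c) \<Rightarrow> bool"
  where "contractive_bilinear S T U f \<longleftrightarrow>
    (\<forall>x\<in>S. \<forall>y\<in>T. f x y \<in> U \<and> norm (f x y) \<le> norm x * norm y) \<and>
    (\<forall>x\<in>S. \<forall>x'\<in>S. \<forall>y\<in>T. f (x + x') y = f x y + f x' y) \<and>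
    (\<forall>x\<in>S. \<forall>y\<in>T. \<forall>y'\<in>T. f x (y + y') = f x y + f x y') \<and>
    (\<forall>c. \<forall>x\<in>S. \<forall>y\<in>T. f (c *\<^sub>C x) y = c *\<^sub>C f x y \<and> f x (c *\<^sub>C y) = c *\<^sub>C f x y)"

text \<open>The closed span of the values of \<open>f\<close> on \<open>S \<times> T\<close>.\<close>

definition span_values :: "('a \<Rightarrow> 'b \<Rightarrow> 'c::complex_banach) \<Rightarrow> 'a set \<Rightarrow> 'b set \<Rightarrow> 'c set"
  where "span_values f S T = closed_span {f x y | x y. x \<in> S \<and> y \<in> T}"

locale banach_bimodule =
  fixes L :: "'l::complex_banach_algebra set" and R :: "'r::complex_banach_algebra set"
    and M :: "'m::complex_banach set"
    and lact :: "'l \<Rightarrow> 'm \<Rightarrow> 'm" and ract :: "'m \<Rightarrow> 'r \<Rightarrow> 'm"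
  assumes left_algebra: "closed_subalgebra L"
    and right_algebra: "closed_subalgebra R"
    and module_space: "closed_csubspace M"
    and left_action: "contractive_bilinear L M M lact"
    and right_action: "contractive_bilinear M R M ract"
    and left_assoc:
      "\<And>b b' m. \<lbrakk>b \<in> L; b' \<in> L; m \<in> M\<rbrakk> \<Longrightarrow> lact (b * b') m = lact b (lact b' m)"
    and right_assoc:
      "\<And>m a a'. \<lbrakk>m \<in> M; a \<in> R; a' \<in> R\<rbrakk> \<Longrightarrow> ract m (a * a') = ract (ract m a) a'"
    and actions_commute:
      "\<And>b m a. \<lbrakk>b \<in> L; m \<in> M; a \<in> R\<rbrakk> \<Longrightarrow> ract (lact b m) a = lact b (ract m a)"

text \<open>
  A Morita equivalence between \<open>A\<close> and \<open>B\<close>, with \<open>El\<close>, \<open>Er\<close> for \<open>E\<^sup><\<close>, \<open>E\<^sup>>\<close>.  The actions are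
  \<open>lB b e\<close> for \<open>b e\<close> and \<open>rA e a\<close> for \<open>e a\<close> on \<open>El\<close>, and \<open>lA a e\<close>, \<open>rB e b\<close> on \<open>Er\<close>; the pairings are
  \<open>pB\<close> with values in \<open>B\<close> and \<open>pA\<close> with values in \<open>A\<close>.  Only the values of these maps on the carriers
  matter, so restricting them means keeping the maps and shrinking the carriers.
\<close>

locale morita_equivalence =
  El: banach_bimodule B A El lB rA + Er: banach_bimodule A B Er lA rB
  for A :: "'a::complex_banach_algebra set" and B :: "'b::complex_banach_algebra set"
    and El :: "'l::complex_banach set" and Er :: "'r::complex_banach set"
    and lB :: "'b \<Rightarrow> 'l \<Rightarrow> 'l" and rA :: "'l \<Rightarrow> 'a \<Rightarrow> 'l"
    and lA :: "'a \<Rightarrow> 'r \<Rightarrow> 'r" and rB :: "'r \<Rightarrow> 'b \<Rightarrow> 'r" +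
  fixes pB :: "'l \<Rightarrow> 'r \<Rightarrow> 'b" and pA :: "'r \<Rightarrow> 'l \<Rightarrow> 'a"
  assumes pairing_B: "contractive_bilinear El Er B pB"
    and pairing_A: "contractive_bilinear Er El A pA"
    and pB_left: "\<And>b e x. \<lbrakk>b \<in> B; e \<in> El; x \<in> Er\<rbrakk> \<Longrightarrow> pB (lB b e) x = b * pB e x"
    and pB_right: "\<And>e x b. \<lbrakk>e \<in> El; x \<in> Er; b \<in> B\<rbrakk> \<Longrightarrow> pB e (rB x b) = pB e x * b"
    and pA_left: "\<And>a x e. \<lbrakk>a \<in> A; x \<in> Er; e \<in> El\<rbrakk> \<Longrightarrow> pA (lA a x) e = a * pA x e"
    and pA_right: "\<And>x e a. \<lbrakk>x \<in> Er; e \<in> El; a \<in> A\<rbrakk> \<Longrightarrow> pA x (rA e a) = pA x e * a"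
    and pB_balanced: "\<And>e a x. \<lbrakk>e \<in> El; a \<in> A; x \<in> Er\<rbrakk> \<Longrightarrow> pB (rA e a) x = pB e (lA a x)"
    and pA_balanced: "\<And>x b e. \<lbrakk>x \<in> Er; b \<in> B; e \<in> El\<rbrakk> \<Longrightarrow> pA (rB x b) e = pA x (lB b e)"
    and compat_left: "\<And>e x f. \<lbrakk>e \<in> El; x \<in> Er; f \<in> El\<rbrakk> \<Longrightarrow> lB (pB e x) f = rA e (pA x f)"
    and compat_right: "\<And>x f y. \<lbrakk>x \<in> Er; f \<in> El; y \<in> Er\<rbrakk> \<Longrightarrow> rB x (pB f y) = lA (pA x f) y"
    and full_B: "span_values pB El Er = B"
    and full_A: "span_values pA Er El = A"
    and nondegenerate_lB: "span_values lB B El = El"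
    and nondegenerate_rA: "span_values rA El A = El"
    and nondegenerate_lA: "span_values lA A Er = Er"
    and nondegenerate_rB: "span_values rB Er B = Er"

text \<open>The submodules \<open>E\<^sup>>\<^sub>I\<close> and \<open>\<^sub>IE\<^sup><\<close> and the induced ideal.\<close>

definition right_restriction ::
    "'l set \<Rightarrow> 'r set \<Rightarrow> ('l \<Rightarrow> 'r \<Rightarrow> 'b) \<Rightarrow> 'b set \<Rightarrow> 'r set"
  where "right_restriction El Er pB I = {x \<in> Er. \<forall>e\<in>El. pB e x \<in> I}"

definition left_restriction ::
    "'l set \<Rightarrow> 'r set \<Rightarrow> ('l \<Rightarrow> 'r \<Rightarrow> 'b) \<Rightarrow> 'b set \<Rightarrow> 'l set"
  where "left_restriction El Er pB I = {e \<in> El. \<forall>x\<in>Er. pB e x \<in> I}"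

definition induced_ideal ::
    "'l set \<Rightarrow> 'r set \<Rightarrow> ('l \<Rightarrow> 'r \<Rightarrow> 'b) \<Rightarrow> ('r \<Rightarrow> 'l \<Rightarrow> 'a::complex_banach) \<Rightarrow> 'b set \<Rightarrow> 'a set"
  where "induced_ideal El Er pB pA I = span_values pA (right_restriction El Er pB I) El"

end

theory Submission
  imports Defs
begin

text \<open>
  Bounded approximate identities act as approximate units on nondegenerate modules, so \<open>\<xi>\<close> lies in
  the closure of \<open>A \<xi>\<close>.  As \<open>A\<close> is spanned by the values of its pairing and
  \<open>\<langle>x, e\<rangle> \<xi> = x \<langle>e, \<xi>\<rangle>\<close>, the module \<open>X\<close> is the closed span of \<open>E\<^sup>> I\<close>, and likewise \<open>Y\<close> that of
  \<open>I E\<^sup><\<close>.  Hence \<open>J\<close> is the closed span of \<open>\<langle>E\<^sup>>, Y\<rangle>\<close> and \<open>I\<close> that of \<open>\<langle>Y, E\<^sup>>\<rangle>\<close>, and in the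
  Morita equivalence with the two algebras exchanged, \<open>J\<close> has restrictions \<open>Y\<close> and \<open>X\<close> and
  induces \<open>I\<close>.  The closed span of \<open>\<langle>Y, X\<rangle>\<close> is that of \<open>I B I\<close>, which is \<open>I\<^sup>2\<close>; so fullness
  forces \<open>I\<^sup>2 = I\<close>, and conversely \<open>I\<^sup>2 = I\<close> yields fullness and nondegeneracy by inserting an
  extra factor from \<open>I\<close>.  The statement for \<open>J\<close> is the one for \<open>I\<close> in the exchanged situation.
\<close>

section \<open>Closed spans and bilinear maps\<close>

lemma continuous_on_scaleC: "continuous_on S ((*\<^sub>C) c :: 'a::complex_banach \<Rightarrow> 'a)"
proof -
  have "bounded_linear ((*\<^sub>C) c :: 'a \<Rightarrow> 'a)"
    by (rule bounded_linear_intro[where K="cmod c"])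
      (auto simp: scaleC_add_right scaleR_scaleC scaleC_scaleC norm_scaleC mult.commute)
  then show ?thesis
    by (rule linear_continuous_on)
qed

lemma subspace_closure:
  fixes S :: "'a::complex_banach set"
  assumes "complex_vector.subspace S"
  shows "complex_vector.subspace (closure S)"
proof (rule complex_vector.subspaceI)
  show "0 \<in> closure S"
    using assms closure_subset complex_vector.subspace_0 by blast
next
  fix x y assume "x \<in> closure S" "y \<in> closure S"
  then obtain f g where "\<And>n::nat. f n \<in> S" "f \<longlonglongrightarrow> x" "\<And>n::nat. g n \<in> S" "g \<longlonglongrightarrow> y"
    unfolding closure_sequential by blast
  then show "x + y \<in> closure S"
    unfolding closure_sequential
    by (intro exI[of _ "\<lambda>n. f n + g n"])
      (auto intro: tendsto_add complex_vector.subspace_add[OF assms])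
next
  fix c x assume "x \<in> closure S"
  moreover have "(*\<^sub>C) c ` closure S \<subseteq> closure S"
    using complex_vector.subspace_scale[OF assms] closure_subset[of S]
    by (intro image_closure_subset[OF continuous_on_scaleC]) auto
  ultimately show "c *\<^sub>C x \<in> closure S"
    by blast
qed

lemma closed_csubspace_closed_span: "closed_csubspace (closed_span S)"
  by (simp add: closed_csubspace_def closed_span_def subspace_closure complex_vector.subspace_span)

lemma closed_span_superset: "S \<subseteq> closed_span S"
  unfolding closed_span_def using complex_vector.span_superset closure_subset by blast

lemma closed_span_minimal:
  assumes "closed_csubspace P" "S \<subseteq> P"
  shows "closed_span S \<subseteq> P"
  using assms unfolding closed_csubspace_def closed_span_def
  by (intro closure_minimal complex_vector.span_minimal) auto

text \<open>Cancellation principle: once \<open>x\<close> is known to be a limit of products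
  \<open>f a\<close>, it suffices to place those products in \<open>P\<close>.\<close>

lemma closure_range_mem:
  assumes "closed_csubspace P" "x \<in> closure (range f)" "\<And>a. f a \<in> P"
  shows "x \<in> P"
  using assms closure_minimal[of "range f" P] by (auto simp: closed_csubspace_def)

lemma closed_csubspace_INT:
  "(\<And>t. closed_csubspace (P t)) \<Longrightarrow> closed_csubspace (\<Inter>t. P t)"
  by (auto simp: closed_csubspace_def complex_vector.subspace_def)

lemma closed_csubspace_vimage:
  assumes "closed_csubspace P" "continuous_on UNIV g"
    "\<And>x y. g (x + y) = g x + g y" "\<And>c x. g (c *\<^sub>C x) = c *\<^sub>C g x"
  shows "closed_csubspace {x. g x \<in> P}"
proof -
  have "g 0 = 0"
    using assms(3)[of 0 0] by simp
  then have "complex_vector.subspace {x. g x \<in> P}"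
    using assms by (auto simp: closed_csubspace_def complex_vector.subspace_def)
  moreover have "closed (g -` P)"
    using assms by (intro closed_vimage) (auto simp: closed_csubspace_def)
  ultimately show ?thesis
    by (simp add: closed_csubspace_def vimage_def)
qed

lemma contractive_bilinear_bounded:
  assumes "contractive_bilinear UNIV UNIV UNIV f"
  shows "bounded_bilinear f"
  using assms unfolding contractive_bilinear_def
  by unfold_locales (auto simp: scaleR_scaleC intro!: exI[of _ 1])

text \<open>Basis of every extension from generators below: with one argument fixed, the good values
  of the other form a closed subspace.\<close>

lemma closed_csubspace_vimage_bilinear:
  assumes f: "contractive_bilinear UNIV UNIV UNIV f" and P: "closed_csubspace P"
  shows "closed_csubspace {x. f x y \<in> P}" "closed_csubspace {y. f x y \<in> P}"
proof -
  interpret bounded_bilinear f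
    using f by (rule contractive_bilinear_bounded)
  show "closed_csubspace {x. f x y \<in> P}" "closed_csubspace {y. f x y \<in> P}"
    using f by (auto intro!: closed_csubspace_vimage[OF P] continuous_on continuous_on_id
        continuous_on_const simp: contractive_bilinear_def)
qed

lemma bilinear_closed_span:
  assumes f: "contractive_bilinear UNIV UNIV UNIV f" and P: "closed_csubspace P"
    and "\<And>s t. s \<in> S \<Longrightarrow> t \<in> T \<Longrightarrow> f s t \<in> P"
    and "x \<in> closed_span S" "y \<in> closed_span T"
  shows "f x y \<in> P"
proof -
  \<comment> \<open>Extension happens one slot at a time: first from \<open>T\<close> to
    \<open>y\<close> with a generator \<open>s\<close> fixed, then from \<open>S\<close> to
    \<open>x\<close> with \<open>y\<close> fixed.\<close>
  have "f s y \<in> P" if "s \<in> S" for s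
    using closed_span_minimal[OF closed_csubspace_vimage_bilinear(2)[OF f P], of T s] assms that
    by auto
  then show ?thesis
    using closed_span_minimal[OF closed_csubspace_vimage_bilinear(1)[OF f P], of S y] assms
    by auto
qed

lemma closed_csubspace_span_values: "closed_csubspace (span_values f S T)"
  by (simp add: span_values_def closed_csubspace_closed_span)

lemma span_values_memI: "x \<in> S \<Longrightarrow> y \<in> T \<Longrightarrow> f x y \<in> span_values f S T"
  unfolding span_values_def using closed_span_superset by fast

lemma span_values_subsetI:
  assumes "closed_csubspace P" "\<And>x y. x \<in> S \<Longrightarrow> y \<in> T \<Longrightarrow> f x y \<in> P"
  shows "span_values f S T \<subseteq> P"
  unfolding span_values_def using assms by (intro closed_span_minimal) auto

lemma bilinear_span_values_left:
  assumes "contractive_bilinear UNIV UNIV UNIV f" "closed_csubspace P"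
    and "\<And>s t. s \<in> S \<Longrightarrow> t \<in> T \<Longrightarrow> f (g s t) y \<in> P" "x \<in> span_values g S T"
  shows "f x y \<in> P"
  \<comment> \<open>Taking \<open>{y}\<close> as the second generating set keeps \<open>y\<close>
    fixed.\<close>
  by (rule bilinear_closed_span[OF assms(1,2), of _ "{y}"])
    (use assms closed_span_superset[of "{y}"] in \<open>auto simp: span_values_def\<close>)

lemma bilinear_span_values_right:
  assumes "contractive_bilinear UNIV UNIV UNIV f" "closed_csubspace P"
    and "\<And>s t. s \<in> S \<Longrightarrow> t \<in> T \<Longrightarrow> f x (g s t) \<in> P" "y \<in> span_values g S T"
  shows "f x y \<in> P"
  by (rule bilinear_closed_span[OF assms(1,2), of "{x}"])
    (use assms closed_span_superset[of "{x}"] in \<open>auto simp: span_values_def\<close>)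

lemma contractive_bilinear_restrict:
  assumes "contractive_bilinear UNIV UNIV UNIV f" "\<And>x y. x \<in> S \<Longrightarrow> y \<in> T \<Longrightarrow> f x y \<in> U"
  shows "contractive_bilinear S T U f"
  using assms by (auto simp: contractive_bilinear_def)

lemma contractive_bilinear_times:
  "contractive_bilinear UNIV UNIV UNIV ((*) :: 'a::complex_banach_algebra \<Rightarrow> 'a \<Rightarrow> 'a)"
  by (simp add: contractive_bilinear_def norm_mult_ineq distrib_left distrib_right
      mult_scaleC_left mult_scaleC_right)

lemma ideal_square_eq_span_values: "ideal_square K = span_values (*) K K"
  by (simp add: ideal_square_def span_values_def)

lemma closed_ideal_closed_subalgebra: "closed_ideal K \<Longrightarrow> closed_subalgebra K"
  by (simp add: closed_ideal_def closed_subalgebra_def)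

lemma ideal_square_subset: "closed_ideal K \<Longrightarrow> ideal_square K \<subseteq> K"
  unfolding ideal_square_eq_span_values
  by (rule span_values_subsetI) (auto simp: closed_ideal_def)

section \<open>Bounded approximate identities\<close>

text \<open>Directedness and transitivity make the tails a filter base, and by reflexivity each tail
  contains its own starting index.\<close>

lemma tails_neq_bot:
  assumes "directed_index \<Lambda> le"
  shows "tails \<Lambda> le \<noteq> bot"
proof -
  have "\<not> eventually (\<lambda>_. False) (tails \<Lambda> le)"
  proof
    assume "eventually (\<lambda>_. False) (tails \<Lambda> le)"
    then have "\<exists>i\<in>\<Lambda>. eventually (\<lambda>_. False) (principal {j \<in> \<Lambda>. le i j})"
      unfolding tails_def
    proof (subst (asm) eventually_INF_base)
      fix i j assume "i \<in> \<Lambda>" "j \<in> \<Lambda>"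
      with assms obtain k where "k \<in> \<Lambda>" "le i k" "le j k"
        by (auto simp: directed_index_def)
      with assms \<open>i \<in> \<Lambda>\<close> \<open>j \<in> \<Lambda>\<close> show "\<exists>k\<in>\<Lambda>. principal {l \<in> \<Lambda>. le k l}
          \<le> inf (principal {l \<in> \<Lambda>. le i l}) (principal {l \<in> \<Lambda>. le j l})"
        by (intro bexI[of _ k]) (auto simp: directed_index_def dest: transp_onD)
    qed (use assms in \<open>auto simp: directed_index_def\<close>)
    with assms show False
      by (auto simp: directed_index_def eventually_principal dest: reflp_onD)
  qed
  then show ?thesis
    by (simp add: trivial_limit_def)
qed

lemma eventually_tails_mem:
  assumes "directed_index \<Lambda> le"
  shows "eventually (\<lambda>i. i \<in> \<Lambda>) (tails \<Lambda> le)"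
proof -
  obtain i where "i \<in> \<Lambda>"
    using assms by (auto simp: directed_index_def)
  then have "tails \<Lambda> le \<le> principal {j \<in> \<Lambda>. le i j}"
    unfolding tails_def by (rule INF_lower)
  then show ?thesis
    by (auto simp: le_principal elim: eventually_mono)
qed

lemma bounded_approximate_identityE:
  fixes K :: "'a::complex_banach_algebra set"
  assumes "has_bounded_approximate_identity TYPE('i) K"
  obtains F :: "'i filter" and u :: "'i \<Rightarrow> 'a" and M
  where "F \<noteq> bot" "eventually (\<lambda>i. u i \<in> K) F" "eventually (\<lambda>i. norm (u i) \<le> M) F"
    "\<And>a. a \<in> K \<Longrightarrow> ((\<lambda>i. u i * a) \<longlongrightarrow> a) F" "\<And>a. a \<in> K \<Longrightarrow> ((\<lambda>i. a * u i) \<longlongrightarrow> a) F"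
proof -
  from assms obtain \<Lambda> :: "'i set" and le u where u: "bounded_approximate_identity K \<Lambda> le u"
    unfolding has_bounded_approximate_identity_def by blast
  then have d: "directed_index \<Lambda> le" and "u ` \<Lambda> \<subseteq> K" and "bounded (u ` \<Lambda>)"
    by (auto simp: bounded_approximate_identity_def)
  from \<open>bounded (u ` \<Lambda>)\<close> obtain M where "\<forall>i\<in>\<Lambda>. norm (u i) \<le> M"
    unfolding bounded_iff by blast
  then have "eventually (\<lambda>i. norm (u i) \<le> M) (tails \<Lambda> le)"
    by (auto intro: eventually_mono[OF eventually_tails_mem[OF d]])
  moreover have "eventually (\<lambda>i. u i \<in> K) (tails \<Lambda> le)"
    using \<open>u ` \<Lambda> \<subseteq> K\<close> by (auto intro: eventually_mono[OF eventually_tails_mem[OF d]])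
  ultimately show ?thesis
    using that[OF tails_neq_bot[OF d]] u by (auto simp: bounded_approximate_identity_def)
qed

text \<open>Each \<open>k\<close> is the limit of the products \<open>u i * k\<close>, whose factors
  eventually both lie in \<open>K\<close>.\<close>

lemma approximate_identity_idempotent:
  assumes "closed_ideal K" "has_bounded_approximate_identity TYPE('i) K"
  shows "ideal_square K = K"
proof (rule equalityI[OF ideal_square_subset[OF assms(1)]], rule subsetI)
  fix k assume k: "k \<in> K"
  obtain F :: "'i filter" and u where u: "F \<noteq> bot" "eventually (\<lambda>i. u i \<in> K) F"
    "((\<lambda>i. u i * k) \<longlongrightarrow> k) F"
    by (rule bounded_approximate_identityE[OF assms(2)]) (use k in blast)
  have "eventually (\<lambda>i. u i * k \<in> ideal_square K) F"
    using u(2) k unfolding ideal_square_eq_span_values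
    by (auto elim!: eventually_mono intro: span_values_memI)
  moreover have "closed (ideal_square K)"
    using closed_csubspace_closed_span by (auto simp: ideal_square_def closed_csubspace_def)
  ultimately show "k \<in> ideal_square K"
    by (intro Lim_in_closed_set[OF _ _ u(1,3)])
qed

text \<open>The vectors on which \<open>u\<close> acts as an approximate unit form a subspace,
  closed because the \<open>u i\<close> are eventually uniformly bounded. It contains the
  generators, hence their closed span.\<close>

lemma approximate_units_on_span_values:
  fixes f :: "'a::complex_banach \<Rightarrow> 'm::complex_banach \<Rightarrow> 'm" and u :: "'i \<Rightarrow> 'a"
  assumes f: "contractive_bilinear UNIV UNIV UNIV f"
    and F: "F \<noteq> bot" "eventually (\<lambda>i. norm (u i) \<le> M) F"
    and u: "\<And>a x. a \<in> S \<Longrightarrow> x \<in> T \<Longrightarrow> ((\<lambda>i. f (u i) (f a x)) \<longlongrightarrow> f a x) F"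
    and x: "x \<in> span_values f S T"
  shows "x \<in> closure (range (\<lambda>a. f a x))"
proof -
  interpret bounded_bilinear f
    using f by (rule contractive_bilinear_bounded)
  have scale: "f a (c *\<^sub>C x) = c *\<^sub>C f a x" and bound: "norm (f a x) \<le> norm a * norm x" for a c x
    using f by (auto simp: contractive_bilinear_def)
  define D where "D = {x. ((\<lambda>i. f (u i) x) \<longlongrightarrow> x) F}"
  have "0 \<in> D"
    by (simp add: D_def zero_right)
  moreover have "x + y \<in> D" if "x \<in> D" "y \<in> D" for x y
    using that by (auto simp: D_def add_right intro: tendsto_add)
  moreover have "c *\<^sub>C x \<in> D" if "x \<in> D" for c x
    using that continuous_on_tendsto_compose[OF continuous_on_scaleC[of UNIV c]]
    by (auto simp: D_def scale)
  ultimately have subspace: "complex_vector.subspace D"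
    by (auto intro: complex_vector.subspaceI)
  have "closure D \<subseteq> D"
  proof
    fix x assume x: "x \<in> closure D"
    have "eventually (\<lambda>i. dist (f (u i) x) x < e) F" if e: "e > 0" for e
    proof -
      \<comment> \<open>The three-term estimate below costs
        \<open>\<bar>M\<bar> * d + d + d\<close>, which this choice makes equal to \<open>e\<close>.
        The absolute value avoids any assumption on the sign of \<open>M\<close>.\<close>
      define d where "d = e / (\<bar>M\<bar> + 2)"
      have "d > 0" using e by (simp add: d_def add_nonneg_pos)
      then obtain y where y: "y \<in> D" "dist y x < d"
        using x by (auto simp: closure_approachable)
      from y(1) \<open>d > 0\<close> have "eventually (\<lambda>i. dist (f (u i) y) y < d) F"
        by (auto simp: D_def tendsto_iff)
      with F(2) show ?thesis
      proof eventually_elim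
        case (elim i)
        have "norm (f (u i) (x - y)) \<le> norm (u i) * norm (x - y)"
          by (rule bound)
        also have "\<dots> \<le> \<bar>M\<bar> * d"
          using elim y(2) by (intro mult_mono) (auto simp: dist_norm norm_minus_commute)
        finally have "norm (f (u i) x - f (u i) y) \<le> \<bar>M\<bar> * d"
          by (simp add: diff_right)
        moreover have "dist (f (u i) x) x
            \<le> norm (f (u i) x - f (u i) y) + dist (f (u i) y) y + dist y x"
          by (smt (verit) dist_norm dist_triangle)
        ultimately have "dist (f (u i) x) x < \<bar>M\<bar> * d + d + d"
          using elim y(2) by linarith
        also have "\<dots> = (\<bar>M\<bar> + 2) * d"
          by (simp add: algebra_simps)
        also have "\<dots> = e"
          by (simp add: d_def)
        finally show ?case .
      qed
    qed
    then show "x \<in> D"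
      by (simp add: D_def tendsto_iff)
  qed
  then have "closed_csubspace D"
    using subspace closure_subset[of D] by (simp add: closed_csubspace_def closure_eq[symmetric])
  then have "span_values f S T \<subseteq> D"
    by (rule span_values_subsetI) (simp add: D_def u)
  with x have "((\<lambda>i. f (u i) x) \<longlongrightarrow> x) F"
    by (auto simp: D_def)
  moreover have "f (u i) x \<in> closure (range (\<lambda>a. f a x))" for i
    by (rule subsetD[OF closure_subset rangeI])
  ultimately show ?thesis
    by (intro Lim_in_closed_set[OF closed_closure _ F(1)] always_eventually) auto
qed

text \<open>The second alternative in \<open>assoc\<close> describes a right action with its
  arguments flipped, so left and right modules are treated together.\<close>

lemma nondegenerate_approximate_units:
  fixes f :: "'a::complex_banach_algebra \<Rightarrow> 'm::complex_banach \<Rightarrow> 'm"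
  assumes bai: "has_bounded_approximate_identity TYPE('i) (UNIV :: 'a set)"
    and f: "contractive_bilinear UNIV UNIV UNIV f"
    and assoc: "(\<forall>a b x. f (a * b) x = f a (f b x)) \<or> (\<forall>a b x. f (a * b) x = f b (f a x))"
    and "span_values f UNIV UNIV = UNIV"
  shows "x \<in> closure (range (\<lambda>a. f a x))"
proof -
  obtain F :: "'i filter" and u :: "'i \<Rightarrow> 'a" and M
    where F: "F \<noteq> bot" "eventually (\<lambda>i. norm (u i) \<le> M) F"
    and u: "\<And>a. ((\<lambda>i. u i * a) \<longlongrightarrow> a) F" "\<And>a. ((\<lambda>i. a * u i) \<longlongrightarrow> a) F"
    by (rule bounded_approximate_identityE[OF bai]) auto
  have "((\<lambda>i. f (u i * a) y) \<longlongrightarrow> f a y) F" "((\<lambda>i. f (a * u i) y) \<longlongrightarrow> f a y) F" for a y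
    by (intro bounded_bilinear.tendsto[OF contractive_bilinear_bounded[OF f]] u tendsto_const)+
  \<comment> \<open>A left action turns \<open>f (u i * a) y\<close> into
    \<open>f (u i) (f a y)\<close>; a flipped right action does so with
    \<open>f (a * u i) y\<close>. Hence both one-sided limits were prepared.\<close>
  then have "((\<lambda>i. f (u i) (f a y)) \<longlongrightarrow> f a y) F" for a y
    using assoc by (elim disjE) simp_all
  then show ?thesis
    by (rule approximate_units_on_span_values[OF f F, where S=UNIV and T=UNIV])
      (simp add: assms)
qed

section \<open>Flipped actions and exchange of the two algebras\<close>

lemma contractive_bilinear_flip:
  "contractive_bilinear S T U f \<Longrightarrow> contractive_bilinear T S U (\<lambda>x y. f y x)"
  by (auto simp: contractive_bilinear_def mult.commute)

lemma span_values_flip: "span_values (\<lambda>x y. f y x) S T = span_values f T S"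
  unfolding span_values_def by (rule arg_cong[where f=closed_span]) auto

lemma morita_equivalence_sym:
  assumes "morita_equivalence A B El Er lB rA lA rB pB pA"
  shows "morita_equivalence B A Er El lA rB lB rA pA pB"
proof -
  interpret morita_equivalence A B El Er lB rA lA rB pB pA
    by (rule assms)
  show ?thesis
    by unfold_locales
      (simp_all add: pairing_A pairing_B pA_left pA_right pB_left pB_right pA_balanced pB_balanced
        compat_left compat_right full_A full_B nondegenerate_lA nondegenerate_rA
        nondegenerate_lB nondegenerate_rB)
qed

lemma morita_equivalence_swap:
  "morita_equivalence A B El Er lB rA lA rB pB pA \<longleftrightarrow>
    morita_equivalence B A Er El lA rB lB rA pA pB"
  by (rule iffI; rule morita_equivalence_sym)

section \<open>Restriction to an ideal\<close>

text \<open>The approximate identities enter only through these closure conditions, which mention no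
  index type. The conditions on the modules and algebras are preserved when the two algebras are
  exchanged, so the locale can be interpreted again with \<open>J\<close> as its ideal.\<close>

locale morita_ideal =
  morita_equivalence UNIV UNIV UNIV UNIV lB rA lA rB pB pA
  for lB :: "'b::complex_banach_algebra \<Rightarrow> 'l::complex_banach \<Rightarrow> 'l"
    and rA :: "'l \<Rightarrow> 'a::complex_banach_algebra \<Rightarrow> 'l"
    and lA :: "'a \<Rightarrow> 'r::complex_banach \<Rightarrow> 'r"
    and rB :: "'r \<Rightarrow> 'b \<Rightarrow> 'r"
    and pB :: "'l \<Rightarrow> 'r \<Rightarrow> 'b"
    and pA :: "'r \<Rightarrow> 'l \<Rightarrow> 'a" +
  fixes I :: "'b set"
  assumes ideal_I: "closed_ideal I"
    and units_lA: "x \<in> closure (range (\<lambda>a. lA a x))"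
    and units_rB: "x \<in> closure (range (\<lambda>b. rB x b))"
    and units_lB: "e \<in> closure (range (\<lambda>b. lB b e))"
    and units_rA: "e \<in> closure (range (\<lambda>a. rA e a))"
    and units_A: "(a::'a) \<in> closure (range (\<lambda>a'. a * a'))"
    and units_B: "(b::'b) \<in> closure (range (\<lambda>b'. b * b'))"
begin

section \<open>The restricted submodules and their generators\<close>

abbreviation X where "X \<equiv> right_restriction UNIV UNIV pB I"
abbreviation Y where "Y \<equiv> left_restriction UNIV UNIV pB I"
abbreviation J where "J \<equiv> induced_ideal UNIV UNIV pB pA I"

lemmas bilinear =
  El.left_action El.right_action Er.left_action Er.right_action pairing_A pairing_B

lemma I_closed: "closed_csubspace I"
  and I_left: "i \<in> I \<Longrightarrow> b * i \<in> I" and I_right: "i \<in> I \<Longrightarrow> i * b \<in> I"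
  using ideal_I by (auto simp: closed_ideal_def)

lemma mem_X: "x \<in> X \<longleftrightarrow> (\<forall>e. pB e x \<in> I)" and mem_Y: "e \<in> Y \<longleftrightarrow> (\<forall>x. pB e x \<in> I)"
  by (auto simp: right_restriction_def left_restriction_def)

lemma rB_I_mem_X: "i \<in> I \<Longrightarrow> rB x i \<in> X" and lB_I_mem_Y: "i \<in> I \<Longrightarrow> lB i e \<in> Y"
  by (simp_all add: mem_X mem_Y pB_left pB_right I_left I_right)

lemma X_lA: "x \<in> X \<Longrightarrow> lA a x \<in> X" and X_rB: "x \<in> X \<Longrightarrow> rB x b \<in> X"
  by (simp_all add: mem_X pB_right pB_balanced[symmetric] I_right)

lemma Y_lB: "e \<in> Y \<Longrightarrow> lB b e \<in> Y" and Y_rA: "e \<in> Y \<Longrightarrow> rA e a \<in> Y"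
  by (simp_all add: mem_Y pB_left pB_balanced I_left)

lemma X_closed: "closed_csubspace X" and Y_closed: "closed_csubspace Y"
proof -
  have "X = (\<Inter>e. {x. pB e x \<in> I})" "Y = (\<Inter>x. {e. pB e x \<in> I})"
    by (auto simp: mem_X mem_Y)
  then show "closed_csubspace X" "closed_csubspace Y"
    by (simp_all only: closed_csubspace_INT closed_csubspace_vimage_bilinear[OF pairing_B I_closed])
qed

text \<open>Fullness reduces \<open>a\<close> to a value \<open>pA y e\<close>, and
  \<open>lA (pA y e) x = rB y (pB e x)\<close> has \<open>pB e x\<close> in \<open>I\<close>.
  Approximate units then lead from \<open>lA a x\<close> back to \<open>x\<close>.\<close>

lemma X_eq: "X = span_values rB UNIV I"
proof
  show "X \<subseteq> span_values rB UNIV I"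
  proof
    fix x assume x: "x \<in> X"
    have "lA a x \<in> span_values rB UNIV I" for a
      by (rule bilinear_span_values_left[OF Er.left_action closed_csubspace_span_values, of UNIV UNIV pA])
        (use x in \<open>auto simp: full_A compat_right[symmetric] mem_X intro: span_values_memI\<close>)
    then show "x \<in> span_values rB UNIV I"
      by (rule closure_range_mem[OF closed_csubspace_span_values units_lA])
  qed
qed (intro span_values_subsetI X_closed rB_I_mem_X)

lemma Y_eq: "Y = span_values lB I UNIV"
proof
  show "Y \<subseteq> span_values lB I UNIV"
  proof
    fix e assume e: "e \<in> Y"
    have "rA e a \<in> span_values lB I UNIV" for a
      by (rule bilinear_span_values_right[OF El.right_action closed_csubspace_span_values, of UNIV UNIV _ pA])
        (use e in \<open>auto simp: full_A compat_left[symmetric] mem_Y intro: span_values_memI\<close>)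
    then show "e \<in> span_values lB I UNIV"
      by (rule closure_range_mem[OF closed_csubspace_span_values units_rA])
  qed
qed (intro span_values_subsetI Y_closed lB_I_mem_Y)

section \<open>The induced ideal, and generators of \<open>J\<close> and \<open>I\<close>\<close>

lemma J_def: "J = span_values pA X UNIV"
  by (simp add: induced_ideal_def)

lemma J_closed: "closed_csubspace J"
  by (simp add: J_def closed_csubspace_span_values)

text \<open>Left factors are absorbed by the submodule \<open>X\<close>, right factors by the
  unrestricted second argument of \<open>pA\<close>.\<close>

lemma closed_ideal_J: "closed_ideal J"
proof -
  have "a * j \<in> J" if "j \<in> J" for a j
    by (rule bilinear_span_values_right[OF contractive_bilinear_times J_closed, of X UNIV _ pA])
      (use that in \<open>auto simp: J_def pA_left[symmetric] intro: span_values_memI X_lA\<close>)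
  moreover have "j * a \<in> J" if "j \<in> J" for a j
    by (rule bilinear_span_values_left[OF contractive_bilinear_times J_closed, of X UNIV pA])
      (use that in \<open>auto simp: J_def pA_right[symmetric] intro: span_values_memI\<close>)
  ultimately show ?thesis
    by (simp add: closed_ideal_def J_closed)
qed

text \<open>A factor \<open>i\<close> from \<open>I\<close> crosses the balanced pairing,
  \<open>pA (rB x i) e = pA x (lB i e)\<close>, trading a generator of \<open>X\<close> for one of
  \<open>Y\<close>.\<close>

lemma J_eq: "J = span_values pA UNIV Y"
proof
  have "pA x e \<in> span_values pA UNIV Y" if "x \<in> X" for x e
    by (rule bilinear_span_values_left[OF pairing_A closed_csubspace_span_values, of UNIV I rB])
      (use that in \<open>auto simp: X_eq[symmetric] pA_balanced intro!: span_values_memI lB_I_mem_Y\<close>)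
  then show "J \<subseteq> span_values pA UNIV Y"
    unfolding J_def by (intro span_values_subsetI closed_csubspace_span_values) auto
  have "pA x e \<in> J" if "e \<in> Y" for x e
    by (rule bilinear_span_values_right[OF pairing_A J_closed, of I UNIV _ lB])
      (use that in \<open>auto simp: Y_eq[symmetric] pA_balanced[symmetric] J_def
        intro!: span_values_memI rB_I_mem_X\<close>)
  then show "span_values pA UNIV Y \<subseteq> J"
    by (intro span_values_subsetI J_closed) auto
qed

text \<open>For \<open>b = pB e x\<close> the product \<open>i * b\<close> equals
  \<open>pB (lB i e) x\<close>, with \<open>lB i e\<close> in \<open>Y\<close>; approximate units of
  the algebra recover \<open>i\<close> from the products \<open>i * b\<close>.\<close>

lemma I_eq: "I = span_values pB Y UNIV"
proof
  have "i * b \<in> span_values pB Y UNIV" if "i \<in> I" for i b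
    by (rule bilinear_span_values_right[OF contractive_bilinear_times closed_csubspace_span_values,
          of UNIV UNIV _ pB])
      (use that in \<open>auto simp: full_B pB_left[symmetric] intro!: span_values_memI lB_I_mem_Y\<close>)
  then show "I \<subseteq> span_values pB Y UNIV"
    by (auto intro: closure_range_mem[OF closed_csubspace_span_values units_B])
qed (intro span_values_subsetI I_closed, simp add: mem_Y)

section \<open>The exchanged situation, with \<open>J\<close> as the ideal\<close>

lemma right_restriction_dual: "right_restriction UNIV UNIV pA J = Y"
proof -
  have "e \<in> Y" if e: "\<And>x. pA x e \<in> J" for e
  proof -
    \<comment> \<open>For a generator \<open>j = pA x e'\<close> with \<open>x\<close> in
      \<open>X\<close>, this is \<open>lB (pB f x) e'\<close>, and \<open>pB f x\<close> lies in
      \<open>I\<close>.\<close>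
    have YJ: "rA f j \<in> Y" if "j \<in> J" for f j
      by (rule bilinear_span_values_right[OF El.right_action Y_closed, of X UNIV _ pA])
        (use that in \<open>auto simp: J_def[symmetric] compat_left[symmetric] mem_X intro!: lB_I_mem_Y\<close>)
    \<comment> \<open>With \<open>b = pB f x\<close>, compatibility gives
      \<open>lB b e = rA f (pA x e)\<close>, to which \<open>YJ\<close> applies.\<close>
    have "lB b e \<in> Y" for b
      by (rule bilinear_span_values_left[OF El.left_action Y_closed, of UNIV UNIV pB])
        (simp_all add: full_B compat_left e YJ)
    then show "e \<in> Y"
      by (rule closure_range_mem[OF Y_closed units_lB])
  qed
  then show ?thesis
    by (auto simp: right_restriction_def J_eq intro: span_values_memI)
qed

lemma left_restriction_dual: "left_restriction UNIV UNIV pA J = X"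
proof -
  have "x \<in> X" if x: "\<And>e. pA x e \<in> J" for x
  proof -
    have JX: "lA j y \<in> X" if "j \<in> J" for j y
      by (rule bilinear_span_values_left[OF Er.left_action X_closed, of UNIV Y pA])
        (use that in \<open>auto simp: J_eq[symmetric] compat_right[symmetric] mem_Y intro!: rB_I_mem_X\<close>)
    have "rB x b \<in> X" for b
      by (rule bilinear_span_values_right[OF Er.right_action X_closed, of UNIV UNIV _ pB])
        (simp_all add: full_B compat_right x JX)
    then show "x \<in> X"
      by (rule closure_range_mem[OF X_closed units_rB])
  qed
  then show ?thesis
    by (auto simp: left_restriction_def J_def intro: span_values_memI)
qed

lemma induced_ideal_dual: "induced_ideal UNIV UNIV pA pB J = I"
  by (simp add: induced_ideal_def[of _ _ pA pB] right_restriction_dual I_eq[symmetric])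

text \<open>Every result of the locale about \<open>I\<close> thereby has a counterpart about
  \<open>J\<close>.\<close>

lemma morita_ideal_dual: "morita_ideal lA rB lB rA pA pB J"
proof -
  interpret dual: morita_equivalence UNIV UNIV UNIV UNIV lA rB lB rA pA pB
    by (rule morita_equivalence_sym) unfold_locales
  show ?thesis
    by unfold_locales
      (rule closed_ideal_J units_lA units_rB units_lB units_rA units_A units_B)+
qed

section \<open>Idempotence and the restricted Morita equivalence\<close>

lemma full_YX: "span_values pB Y X = ideal_square I"
proof
  \<comment> \<open>Generators \<open>lB i f\<close> of \<open>Y\<close> give
    \<open>i * pB f x\<close>, a product of two elements of \<open>I\<close>.\<close>
  have "pB e x \<in> ideal_square I" if "e \<in> Y" "x \<in> X" for e x
    by (rule bilinear_span_values_left[OF pairing_B, of _ I UNIV lB])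
      (use that in \<open>auto simp: Y_eq[symmetric] pB_left mem_X ideal_square_eq_span_values
        intro: span_values_memI closed_csubspace_span_values\<close>)
  then show "span_values pB Y X \<subseteq> ideal_square I"
    unfolding ideal_square_eq_span_values
    by (intro span_values_subsetI closed_csubspace_span_values) auto
  \<comment> \<open>Here \<open>i\<close> is reduced to \<open>pB e x\<close> with \<open>e\<close>
    in \<open>Y\<close>, and \<open>j\<close> moves inside to give
    \<open>pB e (rB x j)\<close>.\<close>
  have "i * j \<in> span_values pB Y X" if "i \<in> I" "j \<in> I" for i j
    by (rule bilinear_span_values_left[OF contractive_bilinear_times closed_csubspace_span_values,
          of Y UNIV pB])
      (use that in \<open>auto simp: I_eq[symmetric] pB_right[symmetric] intro: span_values_memI rB_I_mem_X\<close>)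
  then show "ideal_square I \<subseteq> span_values pB Y X"
    unfolding ideal_square_eq_span_values
    by (intro span_values_subsetI closed_csubspace_span_values) auto
qed

theorem morita_equivalence_imp_idempotent:
  assumes "morita_equivalence J I Y X lB rA lA rB pB pA"
  shows "ideal_square I = I"
  using morita_equivalence.full_B[OF assms] full_YX by simp

text \<open>The algebraic identities are inherited from the ambient equivalence. Fullness and
  nondegeneracy on the smaller carriers are checked on generators, using idempotence to supply a
  second factor from \<open>I\<close>.\<close>

theorem idempotent_imp_morita_equivalence:
  assumes I2: "ideal_square I = I"
  shows "morita_equivalence J I Y X lB rA lA rB pB pA"
proof -
  have full_I: "span_values pB Y X = I" and I2': "span_values (*) I I = I"
    using full_YX I2 by (simp_all add: ideal_square_eq_span_values)
  have pA_X: "pA x e \<in> J" if "x \<in> X" for x e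
    using that by (auto simp: J_def intro: span_values_memI)
  have pA_Y: "pA x e \<in> J" if "e \<in> Y" for x e
    using that by (auto simp: J_eq intro: span_values_memI)
  \<comment> \<open>In a generator \<open>lB i e\<close>, \<open>i\<close> is replaced by a product;
    its right factor moves \<open>e\<close> into \<open>Y\<close>.\<close>
  have Y_IY: "Y \<subseteq> span_values lB I Y"
  proof -
    have "lB i e \<in> span_values lB I Y" if "i \<in> I" for i e
      by (rule bilinear_span_values_left[OF El.left_action closed_csubspace_span_values, of I I "(*)"])
        (use that in \<open>auto simp: I2' El.left_assoc intro: span_values_memI lB_I_mem_Y\<close>)
    then show ?thesis
      by (subst Y_eq, intro span_values_subsetI closed_csubspace_span_values) auto
  qed
  have X_XI: "X \<subseteq> span_values rB X I"
  proof -
    have "rB x i \<in> span_values rB X I" if "i \<in> I" for i x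
      by (rule bilinear_span_values_right[OF Er.right_action closed_csubspace_span_values, of I I _ "(*)"])
        (use that in \<open>auto simp: I2' Er.right_assoc intro: span_values_memI rB_I_mem_X\<close>)
    then show ?thesis
      by (subst X_eq, intro span_values_subsetI closed_csubspace_span_values) auto
  qed
  \<comment> \<open>Now \<open>i\<close> is replaced by \<open>pB f x\<close> with \<open>f\<close>
    in \<open>Y\<close> and \<open>x\<close> in \<open>X\<close>; compatibility turns
    \<open>lB i e\<close> into \<open>rA f (pA x e)\<close>.\<close>
  have Y_YJ: "Y \<subseteq> span_values rA Y J"
  proof -
    have "lB i e \<in> span_values rA Y J" if "i \<in> I" for i e
      by (rule bilinear_span_values_left[OF El.left_action closed_csubspace_span_values, of Y X pB])
        (use that in \<open>auto simp: full_I compat_left intro: span_values_memI pA_X\<close>)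
    then show ?thesis
      by (subst Y_eq, intro span_values_subsetI closed_csubspace_span_values) auto
  qed
  have X_JX: "X \<subseteq> span_values lA J X"
  proof -
    have "rB x i \<in> span_values lA J X" if "i \<in> I" for i x
      by (rule bilinear_span_values_right[OF Er.right_action closed_csubspace_span_values, of Y X _ pB])
        (use that in \<open>auto simp: full_I compat_right intro: span_values_memI pA_Y\<close>)
    then show ?thesis
      by (subst X_eq, intro span_values_subsetI closed_csubspace_span_values) auto
  qed
  \<comment> \<open>By \<open>X_XI\<close> the first argument may be taken as \<open>rB y i\<close>
    with \<open>y\<close> in \<open>X\<close>; moving \<open>i\<close> across the pairing puts the
    second argument into \<open>Y\<close>.\<close>
  have full_J: "J \<subseteq> span_values pA X Y"
  proof -
    have "pA x e \<in> span_values pA X Y" if "x \<in> X" for x e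
      by (rule bilinear_span_values_left[OF pairing_A closed_csubspace_span_values, of X I rB])
        (use that X_XI in \<open>auto simp: pA_balanced intro: span_values_memI lB_I_mem_Y\<close>)
    then show ?thesis
      by (subst J_def, intro span_values_subsetI closed_csubspace_span_values) auto
  qed
  have algebras: "closed_subalgebra I" "closed_subalgebra J"
    using ideal_I closed_ideal_J by (auto intro: closed_ideal_closed_subalgebra)
  show ?thesis
  proof unfold_locales
    show "contractive_bilinear I Y Y lB" "contractive_bilinear Y J Y rA"
      "contractive_bilinear J X X lA" "contractive_bilinear X I X rB"
      "contractive_bilinear Y X I pB" "contractive_bilinear X Y J pA"
      using bilinear by (auto intro: contractive_bilinear_restrict X_lA X_rB Y_lB Y_rA pA_X simp: mem_Y)
    show "span_values pB Y X = I"
      by (rule full_I)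
    show "span_values pA X Y = J"
      using full_J by (intro equalityI span_values_subsetI J_closed pA_X)
    show "span_values lB I Y = Y"
      using Y_IY by (intro equalityI span_values_subsetI Y_closed Y_lB)
    show "span_values rA Y J = Y"
      using Y_YJ by (intro equalityI span_values_subsetI Y_closed Y_rA)
    show "span_values lA J X = X"
      using X_JX by (intro equalityI span_values_subsetI X_closed X_lA)
    show "span_values rB X I = X"
      using X_XI by (intro equalityI span_values_subsetI X_closed X_rB)
  qed (simp_all add: algebras X_closed Y_closed El.left_assoc El.right_assoc El.actions_commute
      Er.left_assoc Er.right_assoc Er.actions_commute pA_left pA_right pB_left pB_right
      pA_balanced pB_balanced compat_left compat_right)
qed

theorem idempotent_iff_morita_equivalence:
  "ideal_square I = I \<longleftrightarrow> morita_equivalence J I Y X lB rA lA rB pB pA"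
  using morita_equivalence_imp_idempotent idempotent_imp_morita_equivalence by blast

theorem induced_idempotent_iff_morita_equivalence:
  "ideal_square J = J \<longleftrightarrow> morita_equivalence J I Y X lB rA lA rB pB pA"
proof -
  interpret dual: morita_ideal lA rB lB rA pA pB J
    by (rule morita_ideal_dual)
  show ?thesis
    \<comment> \<open>The dual restrictions are \<open>Y\<close> and \<open>X\<close> and the dual
      induced ideal is \<open>I\<close>, so this is the same equivalence read from the other
      side.\<close>
    using dual.idempotent_iff_morita_equivalence
    unfolding right_restriction_dual left_restriction_dual induced_ideal_dual
    by (subst morita_equivalence_swap)
qed

end

section \<open>From bounded approximate identities to the full theorem\<close>

lemma algebra_approximate_units:
  assumes "has_bounded_approximate_identity TYPE('i) (UNIV :: 'a::complex_banach_algebra set)"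
  shows "(a::'a) \<in> closure (range (\<lambda>a'. a * a'))"
proof -
  obtain F :: "'i filter" and u where "F \<noteq> bot" "((\<lambda>i. a * u i) \<longlongrightarrow> a) F"
    by (rule bounded_approximate_identityE[OF assms]) auto
  then show ?thesis
    using closure_subset[of "range (\<lambda>a'. a * a')"]
    by (intro Lim_in_closed_set[OF closed_closure, of "\<lambda>i. a * u i"])
      (auto intro!: always_eventually)
qed

lemma morita_idealI:
  fixes lB :: "'b::complex_banach_algebra \<Rightarrow> 'l::complex_banach \<Rightarrow> 'l"
    and lA :: "'a::complex_banach_algebra \<Rightarrow> 'r::complex_banach \<Rightarrow> 'r"
  assumes bai_A: "has_bounded_approximate_identity TYPE('i) (UNIV :: 'a set)"
    and bai_B: "has_bounded_approximate_identity TYPE('j) (UNIV :: 'b set)"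
    and morita: "morita_equivalence UNIV UNIV UNIV UNIV lB rA lA rB pB pA"
    and ideal_I: "closed_ideal I"
  shows "morita_ideal lB rA lA rB pB pA I"
proof -
  interpret morita_equivalence UNIV UNIV UNIV UNIV lB rA lA rB pB pA
    by (rule morita)
  show ?thesis
  proof unfold_locales
    show "x \<in> closure (range (\<lambda>a. lA a x))" for x
      by (rule nondegenerate_approximate_units[OF bai_A])
        (simp_all add: Er.left_action Er.left_assoc nondegenerate_lA)
    show "x \<in> closure (range (\<lambda>b. rB x b))" for x
      by (rule nondegenerate_approximate_units[OF bai_B contractive_bilinear_flip[OF Er.right_action]])
        (simp_all add: Er.right_assoc nondegenerate_rB span_values_flip[of rB])
    show "e \<in> closure (range (\<lambda>b. lB b e))" for e
      by (rule nondegenerate_approximate_units[OF bai_B])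
        (simp_all add: El.left_action El.left_assoc nondegenerate_lB)
    show "e \<in> closure (range (\<lambda>a. rA e a))" for e
      by (rule nondegenerate_approximate_units[OF bai_A contractive_bilinear_flip[OF El.right_action]])
        (simp_all add: El.right_assoc nondegenerate_rA span_values_flip[of rA])
  qed (intro ideal_I algebra_approximate_units[OF bai_A] algebra_approximate_units[OF bai_B])+
qed

theorem theorem2p12:
  fixes lB :: "'b::complex_banach_algebra \<Rightarrow> 'l::complex_banach \<Rightarrow> 'l"
    and rA :: "'l \<Rightarrow> 'a::complex_banach_algebra \<Rightarrow> 'l"
    and lA :: "'a \<Rightarrow> 'r::complex_banach \<Rightarrow> 'r"
    and rB :: "'r \<Rightarrow> 'b \<Rightarrow> 'r"
    and pB :: "'l \<Rightarrow> 'r \<Rightarrow> 'b"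
    and pA :: "'r \<Rightarrow> 'l \<Rightarrow> 'a"
    and I :: "'b set" and J :: "'a set" and X :: "'r set" and Y :: "'l set"
  assumes bai_A: "has_bounded_approximate_identity TYPE('i) (UNIV :: 'a set)"
    and bai_B: "has_bounded_approximate_identity TYPE('j) (UNIV :: 'b set)"
    and morita: "morita_equivalence UNIV UNIV UNIV UNIV lB rA lA rB pB pA"
    and ideal_I: "closed_ideal I"
    and J_eq: "J = induced_ideal UNIV UNIV pB pA I"
    and X_eq: "X = right_restriction UNIV UNIV pB I"
    and Y_eq: "Y = left_restriction UNIV UNIV pB I"
  shows "closed_ideal J \<and>
    (ideal_square I = I \<longleftrightarrow> ideal_square J = J) \<and>
    (ideal_square J = J \<longleftrightarrow> morita_equivalence J I Y X lB rA lA rB pB pA) \<and>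
    (has_bounded_approximate_identity TYPE('k) I \<or> has_bounded_approximate_identity TYPE('m) J
      \<longrightarrow> morita_equivalence J I Y X lB rA lA rB pB pA)"
proof -
  interpret M: morita_ideal lB rA lA rB pB pA I
    using bai_A bai_B morita ideal_I by (rule morita_idealI)
  have J: "closed_ideal J"
    unfolding J_eq by (rule M.closed_ideal_J)
  have I_iff: "ideal_square I = I \<longleftrightarrow> morita_equivalence J I Y X lB rA lA rB pB pA"
    unfolding J_eq X_eq Y_eq by (rule M.idempotent_iff_morita_equivalence)
  have J_iff: "ideal_square J = J \<longleftrightarrow> morita_equivalence J I Y X lB rA lA rB pB pA"
    unfolding J_eq X_eq Y_eq by (rule M.induced_idempotent_iff_morita_equivalence)
  show ?thesis
    \<comment> \<open>Expressing the Morita condition as \<open>ideal_square I = I\<close> leaves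
      only claims about idempotence, besides that \<open>J\<close> is an ideal.\<close>
    unfolding I_iff[symmetric]
  proof (intro conjI impI)
    show "closed_ideal J"
      by (rule J)
    show "ideal_square I = I \<longleftrightarrow> ideal_square J = J" "ideal_square J = J \<longleftrightarrow> ideal_square I = I"
      by (simp_all only: I_iff J_iff)
    assume "has_bounded_approximate_identity TYPE('k) I \<or> has_bounded_approximate_identity TYPE('m) J"
    then show "ideal_square I = I"
    proof
      assume "has_bounded_approximate_identity TYPE('k) I"
      with ideal_I show ?thesis
        by (rule approximate_identity_idempotent)
    next
      assume "has_bounded_approximate_identity TYPE('m) J"
      with J have "ideal_square J = J"
        by (rule approximate_identity_idempotent)
      then show ?thesis
        by (simp only: I_iff J_iff)
    qed
  qed
qed

end
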